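(* Let $G$ be a finite simple graph that is $(P_3\cup P_2,K_4)$-free and also free of the co-domino and the co-A. Let $D_1=\{x\in V(G): \omega(G-N(x))\le 2\}$ and $D_2=V(G)\setminus D_1$. If $G[D_2]$ is not isomorphic to an induced subgraph of $K_3$, then $\chi(G)\le 7$.
   Context: $P_n$ is the path on $n$ vertices, $K_n$ the complete graph on $n$ vertices, $\cup$ disjoint union; "free" refers to induced subgraphs. $N(x)$ is the open neighborhood of $x$ and $G-N(x)$ the subgraph induced by $V(G)\setminus N(x)$; $\omega$ is the clique number and $\chi$ the chromatic number. Let $C=u_1v_1v_2v_3u_3u_2$ be a $6$-cycle (edges $u_1v_1, v_1v_2, v_2v_3, v_3u_3, u_3u_2, u_2u_1$). The co-domino is obtained from $C$ by adding edges $v_1v_3$ and $u_1u_3$; the co-A is obtained from $C$ by adding edges $v_1v_3$, $u_1u_3$ and $u_1v_3$. *)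

theory Defs
  imports Main
begin

definition simple_graph :: "'a set \<Rightarrow> ('a \<Rightarrow> 'a \<Rightarrow> bool) \<Rightarrow> bool" where
  "simple_graph V E \<longleftrightarrow> finite V \<and> (\<forall>x y. E x y \<longrightarrow> E y x)
     \<and> (\<forall>x. \<not> E x x) \<and> (\<forall>x y. E x y \<longrightarrow> x \<in> V \<and> y \<in> V)"

definition induced_embeds ::
  "'b set \<Rightarrow> ('b \<Rightarrow> 'b \<Rightarrow> bool) \<Rightarrow> 'a set \<Rightarrow> ('a \<Rightarrow> 'a \<Rightarrow> bool) \<Rightarrow> bool" where
  "induced_embeds HV HE V E \<longleftrightarrow> (\<exists>f. inj_on f HV \<and> f ` HV \<subseteq> V \<and>
      (\<forall>x\<in>HV. \<forall>y\<in>HV. HE x y \<longleftrightarrow> E (f x) (f y)))"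

definition H_free :: "'b set \<Rightarrow> ('b \<Rightarrow> 'b \<Rightarrow> bool) \<Rightarrow> 'a set \<Rightarrow> ('a \<Rightarrow> 'a \<Rightarrow> bool) \<Rightarrow> bool" where
  "H_free HV HE V E \<longleftrightarrow> \<not> induced_embeds HV HE V E"

definition edges_of :: "(nat \<times> nat) list \<Rightarrow> nat \<Rightarrow> nat \<Rightarrow> bool" where
  "edges_of es x y \<longleftrightarrow> (x, y) \<in> set es \<or> (y, x) \<in> set es"

definition P3_P2_V :: "nat set" where "P3_P2_V = {..<5}"
definition P3_P2_E :: "nat \<Rightarrow> nat \<Rightarrow> bool" where
  "P3_P2_E = edges_of [(0,1),(1,2),(3,4)]"

definition K_V :: "nat \<Rightarrow> nat set" where "K_V n = {..<n}"
definition K_E :: "nat \<Rightarrow> nat \<Rightarrow> nat \<Rightarrow> bool" where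
  "K_E n x y \<longleftrightarrow> x < n \<and> y < n \<and> x \<noteq> y"

text \<open>Vertices of the 6-cycle C = u1 v1 v2 v3 u3 u2 numbered
  u1=0, v1=1, v2=2, v3=3, u3=4, u2=5.\<close>
definition C6_edges :: "(nat \<times> nat) list" where
  "C6_edges = [(0,1),(1,2),(2,3),(3,4),(4,5),(5,0)]"

definition codomino_V :: "nat set" where "codomino_V = {..<6}"
definition codomino_E :: "nat \<Rightarrow> nat \<Rightarrow> bool" where
  "codomino_E = edges_of (C6_edges @ [(1,3),(0,4)])"

definition coA_V :: "nat set" where "coA_V = {..<6}"
definition coA_E :: "nat \<Rightarrow> nat \<Rightarrow> bool" where
  "coA_E = edges_of (C6_edges @ [(1,3),(0,4),(0,3)])"

definition clique :: "('a \<Rightarrow> 'a \<Rightarrow> bool) \<Rightarrow> 'a set \<Rightarrow> bool" where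
  "clique E K \<longleftrightarrow> (\<forall>x\<in>K. \<forall>y\<in>K. x \<noteq> y \<longrightarrow> E x y)"

definition clique_number :: "'a set \<Rightarrow> ('a \<Rightarrow> 'a \<Rightarrow> bool) \<Rightarrow> nat" where
  "clique_number S E = Max {card K | K. K \<subseteq> S \<and> clique E K}"

definition nbhd :: "('a \<Rightarrow> 'a \<Rightarrow> bool) \<Rightarrow> 'a \<Rightarrow> 'a set" where
  "nbhd E x = {y. E x y}"

definition proper_colouring :: "'a set \<Rightarrow> ('a \<Rightarrow> 'a \<Rightarrow> bool) \<Rightarrow> nat \<Rightarrow> ('a \<Rightarrow> nat) \<Rightarrow> bool" where
  "proper_colouring V E k c \<longleftrightarrow> c ` V \<subseteq> {..<k} \<and>
     (\<forall>x\<in>V. \<forall>y\<in>V. E x y \<longrightarrow> c x \<noteq> c y)"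

definition chromatic_number :: "'a set \<Rightarrow> ('a \<Rightarrow> 'a \<Rightarrow> bool) \<Rightarrow> nat" where
  "chromatic_number V E = (LEAST k. \<exists>c. proper_colouring V E k c)"

end

theory Submission
  imports Defs
begin

text \<open>
  If a suitable induced subgraph (a core) is present, the colour of a vertex can be read off from
  its neighbourhood in the core: the forbidden subgraphs leave few possible neighbourhoods and rule
  out edges between many pairs of them. Seven cores are treated in this way one after the other.
  Five contain the wheel with five spokes; the last two consist of a triangle \<open>abc\<close>, an edge in the
  private neighbourhood of \<open>a\<close> and an edge in the private neighbourhood of \<open>b\<close>. If no core occurs, at
  most one vertex of a triangle \<open>abc\<close> has an edge in its private neighbourhood. The vertices with
  two neighbours in \<open>abc\<close> form three stable sets, and as the non-neighbours of an edge induce a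
  disjoint union of cliques, four colours are left over for all other vertices; only if a triangle
  has two vertices in the private neighbourhood of \<open>a\<close> and one missing \<open>abc\<close> must they take a fifth,
  but then one of the three stable sets shrinks to \<open>{c}\<close>.
\<close>

subsection \<open>Colouring by stable sets and cliques\<close>

definition colourable :: "('a \<Rightarrow> 'a \<Rightarrow> bool) \<Rightarrow> 'a set \<Rightarrow> nat \<Rightarrow> bool" where
  "colourable E S k \<longleftrightarrow> (\<exists>c. proper_colouring S E k c)"

definition stable_set :: "('a \<Rightarrow> 'a \<Rightarrow> bool) \<Rightarrow> 'a set \<Rightarrow> bool" where
  "stable_set E S \<longleftrightarrow> (\<forall>x\<in>S. \<forall>y\<in>S. \<not> E x y)"

lemma chromatic_number_le: "colourable E V k \<Longrightarrow> chromatic_number V E \<le> k"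
  unfolding colourable_def chromatic_number_def by (rule Least_le)

lemma colourable_stable_cover:
  assumes "\<And>x. x \<in> S \<Longrightarrow> \<exists>i<k. x \<in> A i" and "\<And>i. i < k \<Longrightarrow> stable_set E (A i)"
  shows "colourable E S k"
proof -
  have "\<forall>x\<in>S. \<exists>i. i < k \<and> x \<in> A i"
    using assms(1) by blast
  then obtain c where "\<forall>x\<in>S. c x < k \<and> x \<in> A (c x)"
    by (rule bchoice[THEN exE])
  then have "proper_colouring S E k c"
    using assms(2) unfolding proper_colouring_def stable_set_def by fastforce
  then show ?thesis
    unfolding colourable_def by blast
qed

lemma colourable_stable: "stable_set E S \<Longrightarrow> colourable E S 1"
  by (rule colourable_stable_cover[where A = "\<lambda>_. S"]) auto

lemma colourable_Un:
  assumes "colourable E S j" and "colourable E T k"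
  shows "colourable E (S \<union> T) (j + k)"
proof -
  obtain c d where c: "proper_colouring S E j c" and d: "proper_colouring T E k d"
    using assms unfolding colourable_def by blast
  \<comment> \<open>The colours of \<open>T\<close> are shifted past those of \<open>S\<close>, so
    edges between the two sets cannot clash; the overlap keeps its colour from
    \<open>c\<close>.\<close>
  have "proper_colouring (S \<union> T) E (j + k) (\<lambda>x. if x \<in> S then c x else j + d x)"
    using c d unfolding proper_colouring_def image_subset_iff
    by (auto simp: trans_less_add1)
  then show ?thesis
    unfolding colourable_def by blast
qed

lemma colourable_mono:
  assumes "colourable E T j" and "S \<subseteq> T" and "j \<le> k"
  shows "colourable E S k"
proof -
  obtain c where "proper_colouring T E j c"
    using assms(1) unfolding colourable_def by blast
  then have "proper_colouring S E k c"
    using assms(2,3) unfolding proper_colouring_def image_subset_iff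
    by (meson lessThan_iff order_less_le_trans subsetD)
  then show ?thesis
    unfolding colourable_def by blast
qed

text \<open>A graph without induced \<open>P\<^sub>3\<close> is a disjoint union of cliques.\<close>

lemma colourable_cliques:
  assumes "finite S" and sym: "\<And>x y. E x y \<Longrightarrow> E y x"
    and trans: "\<And>x y z. \<lbrakk>x \<in> S; y \<in> S; z \<in> S; E x y; E y z; x \<noteq> z\<rbrakk> \<Longrightarrow> E x z"
    and small: "\<And>K. \<lbrakk>K \<subseteq> S; clique E K\<rbrakk> \<Longrightarrow> card K \<le> k"
    and irrefl: "\<And>x. \<not> E x x"
  shows "colourable E S k"
proof -
  define comp where "comp x = {y \<in> S. y = x \<or> E x y}" for x
  \<comment> \<open>The injection is chosen per set, not per vertex: adjacent vertices have the same
    \<open>comp\<close>, hence use the same injection and get different colours.\<close>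
  define col where "col K = (SOME h. inj_on h K \<and> h ` K \<subseteq> {..<k})" for K :: "'a set"
  have col: "inj_on (col (comp x)) (comp x) \<and> col (comp x) ` comp x \<subseteq> {..<k}" if "x \<in> S" for x
  proof -
    have fin: "finite (comp x)"
      using assms(1) unfolding comp_def by simp
    have "clique E (comp x)"
      using that sym trans unfolding clique_def comp_def by blast
    then have "card (comp x) \<le> card {..<k}"
      using small[of "comp x"] unfolding comp_def by auto
    then have "\<exists>h. inj_on h (comp x) \<and> h ` comp x \<subseteq> {..<k}"
      using card_le_inj[OF fin, of "{..<k}"] by auto
    then show ?thesis
      unfolding col_def by (rule someI_ex)
  qed
  have same: "comp x = comp y" if "x \<in> S" "y \<in> S" "E x y" for x y
    using that sym trans unfolding comp_def by blast
  have mem: "x \<in> comp x" if "x \<in> S" for x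
    using that unfolding comp_def by simp
  have "proper_colouring S E k (\<lambda>x. col (comp x) x)"
    unfolding proper_colouring_def
  proof (intro conjI ballI impI)
    show "(\<lambda>x. col (comp x) x) ` S \<subseteq> {..<k}"
      using col mem by blast
  next
    fix x y assume xy: "x \<in> S" "y \<in> S" "E x y"
    then have "x \<noteq> y"
      using irrefl by blast
    then show "col (comp x) x \<noteq> col (comp y) y"
      using col[OF xy(1)] same[OF xy] mem xy(1,2) unfolding inj_on_def by metis
  qed
  then show ?thesis
    unfolding colourable_def by blast
qed

subsection \<open>Certified colourings around an induced subgraph\<close>

text \<open>
  A pattern \<open>(n, es)\<close> found in the graph is called a core. Every other vertex has a type, its
  neighbourhood in the core, and a colouring of the types by \<open>m\<close> colours is proper as soon as two
  adjacent vertices never have types of the same colour. This is witnessed by embeddings of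
  forbidden patterns into the core extended by two adjacent vertices, which get the indices \<open>n\<close>
  and \<open>n + 1\<close>; an embedding lists the images of the vertices \<open>0, 1, \<dots>\<close> of the forbidden pattern.
\<close>

type_synonym pattern = "nat \<times> (nat \<times> nat) list"

fun occurs :: "pattern \<Rightarrow> 'a set \<Rightarrow> ('a \<Rightarrow> 'a \<Rightarrow> bool) \<Rightarrow> bool" where
  "occurs (k, hs) V E \<longleftrightarrow> induced_embeds {..<k} (edges_of hs) V E"

text \<open>The adjacencies between the vertex \<open>w\<close> and the core that the embedding \<open>vs\<close> prescribes;
  \<open>None\<close> where it prescribes nothing.\<close>

fun literals :: "pattern \<Rightarrow> nat list \<Rightarrow> nat \<Rightarrow> nat \<Rightarrow> bool option list" where
  "literals (k, hs) vs n w =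
     (let pos = map_of (zip vs [0..<k])
      in map (\<lambda>i. case (pos i, pos w) of
                    (Some a, Some b) \<Rightarrow> Some (edges_of hs a b) | _ \<Rightarrow> None) [0..<n])"

text \<open>Pairs of a core and an outer vertex are left unchecked, since they become the literals
  of a clause. Two outer vertices are assumed adjacent, so the pattern must have an edge there; one
  orientation suffices because \<open>edges_of\<close> is symmetric.\<close>

fun embedding_ok :: "pattern \<Rightarrow> pattern \<Rightarrow> nat list \<Rightarrow> bool" where
  "embedding_ok (n, es) (k, hs) vs \<longleftrightarrow> length vs = k \<and> distinct vs
     \<and> list_all (\<lambda>x. x < n + 2) vs
     \<and> list_all (\<lambda>a. \<not> edges_of hs a a \<and> list_all (\<lambda>b.
           (vs ! a < n \<and> vs ! b < n \<longrightarrow> edges_of hs a b = edges_of es (vs ! a) (vs ! b))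
         \<and> (vs ! a = n \<and> vs ! b = Suc n \<longrightarrow> edges_of hs a b)) [0..<k]) [0..<k]"

definition agrees :: "bool option list \<Rightarrow> bool list \<Rightarrow> bool" where
  "agrees = list_all2 (\<lambda>l b. case l of None \<Rightarrow> True | Some c \<Rightarrow> b = c)"

text \<open>The literals at the vertices \<open>n\<close> and \<open>n + 1\<close>; the second component is \<open>None\<close> if the embedding
  avoids \<open>n + 1\<close>, so that the clause restricts the type of a single vertex.\<close>

type_synonym clause = "bool option list \<times> bool option list option"

definition clause_of :: "nat \<Rightarrow> pattern \<Rightarrow> nat list \<Rightarrow> clause" where
  "clause_of n p vs = (literals p vs n n,
     if List.member vs (Suc n) then Some (literals p vs n (Suc n)) else None)"

fun refutes1 :: "bool list \<Rightarrow> clause \<Rightarrow> bool" where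
  "refutes1 s (c, d) \<longleftrightarrow> d = None \<and> agrees c s"

fun refutes2 :: "bool list \<Rightarrow> bool list \<Rightarrow> clause \<Rightarrow> bool" where
  "refutes2 s t (c, d) \<longleftrightarrow> agrees c s \<and> (case d of None \<Rightarrow> True | Some c' \<Rightarrow> agrees c' t)"

text \<open>The head is also tested against itself, because two vertices of the same type might be
  adjacent. Each unordered pair is tested in one order only.\<close>

fun pairs_refuted :: "clause list \<Rightarrow> bool list list \<Rightarrow> bool" where
  "pairs_refuted cs [] \<longleftrightarrow> True"
| "pairs_refuted cs (s # ss) \<longleftrightarrow>
     list_all (\<lambda>t. list_ex (refutes2 s t) cs) (s # ss) \<and> pairs_refuted cs ss"

definition vec :: "nat \<Rightarrow> nat list \<Rightarrow> bool list" where
  "vec n s = map (List.member s) [0..<n]"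

fun all_vecs :: "nat \<Rightarrow> bool list list" where
  "all_vecs 0 = [[]]"
| "all_vecs (Suc n) = map ((#) True) (all_vecs n) @ map ((#) False) (all_vecs n)"

text \<open>The core vertices of a colour and the types of that colour. A core vertex may have another
  colour than the vertices with the same neighbourhood in the core.\<close>

type_synonym colour_class = "nat list \<times> nat list list"

fun class_ok :: "pattern \<Rightarrow> clause list \<Rightarrow> colour_class \<Rightarrow> bool" where
  "class_ok (n, es) cs (K, S) \<longleftrightarrow>
     list_all (\<lambda>i. list_all (\<lambda>j. \<not> edges_of es i j) K \<and> list_all (\<lambda>s. \<not> List.member s i) S \<and> i < n) K
     \<and> pairs_refuted cs (map (vec n) S)"

definition covers :: "nat \<Rightarrow> clause list \<Rightarrow> bool list list \<Rightarrow> bool" where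
  "covers n cs ts \<longleftrightarrow> list_all (\<lambda>s. List.member ts s \<or> list_ex (refutes1 s) cs) (all_vecs n)"

definition certificate ::
  "pattern list \<Rightarrow> pattern \<Rightarrow> colour_class list \<Rightarrow> (pattern \<times> nat list list) list \<Rightarrow> bool" where
  "certificate F H cls ws \<longleftrightarrow>
     (let n = fst H; cs = concat (map (\<lambda>(p, vss). map (clause_of n p) vss) ws)
      in list_all (\<lambda>(p, vss). List.member F p \<and> list_all (embedding_ok H p) vss) ws
       \<and> list_all (\<lambda>i. list_ex (\<lambda>(K, S). List.member K i) cls) [0..<n]
       \<and> covers n cs (concat (map (\<lambda>(K, S). map (vec n) S) cls))
       \<and> list_all (class_ok H cs) cls)"

section \<open>Soundness of certificates\<close>

lemma edges_of_sym: "edges_of hs a b = edges_of hs b a"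
  unfolding edges_of_def by blast

lemma member_all_vecs: "length s = n \<Longrightarrow> s \<in> set (all_vecs n)"
proof (induction n arbitrary: s)
  case (Suc n)
  then obtain b s' where "s = b # s'" "length s' = n"
    by (auto simp: length_Suc_conv)
  then show ?case
    using Suc.IH by (cases b) auto
qed simp

lemma agrees_literals:
  assumes "agrees (literals (k, hs) vs n w) (map f [0..<n])"
    and vs: "length vs = k" "distinct vs" and ab: "a < k" "b < k" "vs ! a < n" "vs ! b = w"
  shows "f (vs ! a) = edges_of hs a b"
proof -
  \<comment> \<open>As \<open>vs\<close> is distinct, this map inverts \<open>nth vs\<close>, so the
    literal at \<open>vs ! a\<close> is the adjacency of \<open>a\<close> and \<open>b\<close> in
    the pattern.\<close>
  have pos: "map_of (zip vs [0..<k]) (vs ! j) = Some j" if "j < k" for j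
    using map_of_zip_nth[of vs "[0..<k]" j] vs that by simp
  have "vs ! a < length (literals (k, hs) vs n w)"
    using ab by (simp add: Let_def)
  then have "case literals (k, hs) vs n w ! (vs ! a) of None \<Rightarrow> True
      | Some c \<Rightarrow> map f [0..<n] ! (vs ! a) = c"
    using assms(1) unfolding agrees_def by (rule list_all2_nthD[rotated])
  then show ?thesis
    using pos[OF ab(1)] pos[OF ab(2)] ab by (simp add: Let_def)
qed

text \<open>\<open>g\<close> realises the core on the indices below \<open>n\<close> and the outer
  vertices at \<open>n\<close> and \<open>Suc n\<close>. The assumptions on the latter are
  conditional since \<open>vs\<close> may avoid either index. Core pairs are settled by
  \<open>embedding_ok\<close>, mixed pairs by the literals, the outer pair by its edge.\<close>

lemma embedding_occurs:
  assumes ok: "embedding_ok (n, es) (k, hs) vs"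
    and inj: "inj_on g (set vs)" and V: "g ` set vs \<subseteq> V"
    and sym: "\<And>x y. E x y \<Longrightarrow> E y x" and irrefl: "\<And>x. \<not> E x x"
    and es: "\<And>i j. \<lbrakk>i < n; j < n\<rbrakk> \<Longrightarrow> edges_of es i j = E (g i) (g j)"
    and u: "n \<in> set vs \<Longrightarrow> agrees (literals (k, hs) vs n n) (map (\<lambda>i. E (g i) (g n)) [0..<n])"
    and v: "Suc n \<in> set vs \<Longrightarrow>
      agrees (literals (k, hs) vs n (Suc n)) (map (\<lambda>i. E (g i) (g (Suc n))) [0..<n])"
    and uv: "\<lbrakk>n \<in> set vs; Suc n \<in> set vs\<rbrakk> \<Longrightarrow> E (g n) (g (Suc n))"
  shows "occurs (k, hs) V E"
proof -
  have len: "length vs = k" and dist: "distinct vs" and bound: "\<And>a. a < k \<Longrightarrow> vs ! a < n + 2"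
    and hs: "\<And>a. a < k \<Longrightarrow> \<not> edges_of hs a a"
    and core: "\<And>a b. \<lbrakk>a < k; b < k; vs ! a < n; vs ! b < n\<rbrakk>
      \<Longrightarrow> edges_of hs a b = edges_of es (vs ! a) (vs ! b)"
    and edge: "\<And>a b. \<lbrakk>a < k; b < k; vs ! a = n; vs ! b = Suc n\<rbrakk> \<Longrightarrow> edges_of hs a b"
    using ok by (auto simp: list_all_iff)
  have E_sym: "E x y = E y x" for x y
    using sym by blast
  have in_vs: "vs ! a \<in> set vs" if "a < k" for a
    using that len by simp
  have out: "edges_of hs a b = E (g (vs ! a)) (g (vs ! b))"
    if ab: "a < k" "b < k" "vs ! a < n" "\<not> vs ! b < n" for a b
  proof -
    consider "vs ! b = n" | "vs ! b = Suc n"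
      using bound[OF ab(2)] ab(4) by linarith
    then show ?thesis
    proof cases
      case 1
      then show ?thesis
        using agrees_literals[OF u len dist ab(1-3)] in_vs[OF ab(2)] by simp
    next
      case 2
      then show ?thesis
        using agrees_literals[OF v len dist ab(1-3)] in_vs[OF ab(2)] by simp
    qed
  qed
  have both: "edges_of hs a b = E (g (vs ! a)) (g (vs ! b))"
    if ab: "a < k" "b < k" "vs ! a = n" "vs ! b = Suc n" for a b
    using edge[OF ab] uv in_vs[OF ab(1)] in_vs[OF ab(2)] ab by simp
  have "edges_of hs a b = E (g (vs ! a)) (g (vs ! b))" if ab: "a < k" "b < k" for a b
  proof (cases "a = b")
    case True
    then show ?thesis
      using hs ab irrefl by simp
  next
    case False
    then have ne: "vs ! a \<noteq> vs ! b"
      using dist len ab by (simp add: nth_eq_iff_index_eq)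
    consider "vs ! a < n" "vs ! b < n" | "vs ! a < n" "\<not> vs ! b < n"
      | "\<not> vs ! a < n" "vs ! b < n" | "vs ! a = n" "vs ! b = Suc n" | "vs ! a = Suc n" "vs ! b = n"
      using bound[OF ab(1)] bound[OF ab(2)] ne by linarith
    then show ?thesis
    proof cases
      case 1
      then show ?thesis
        using core[OF ab] es by simp
    next
      case 2
      then show ?thesis
        using out[OF ab] by simp
    next
      case 3
      then show ?thesis
        using out[OF ab(2,1)] E_sym edges_of_sym by metis
    next
      case 4
      then show ?thesis
        using both[OF ab] by simp
    next
      case 5
      then show ?thesis
        using both[OF ab(2,1)] E_sym edges_of_sym by metis
    qed
  qed
  moreover have "inj_on (\<lambda>a. g (vs ! a)) {..<k}"
  proof (rule inj_onI)
    fix a b assume ab: "a \<in> {..<k}" "b \<in> {..<k}" "g (vs ! a) = g (vs ! b)"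
    then have "vs ! a = vs ! b"
      using inj_onD[OF inj ab(3)] in_vs by simp
    then show "a = b"
      using ab dist len by (simp add: nth_eq_iff_index_eq)
  qed
  moreover have "(\<lambda>a. g (vs ! a)) ` {..<k} \<subseteq> V"
    using V in_vs by auto
  ultimately show ?thesis
    by (auto simp: induced_embeds_def intro!: exI[of _ "\<lambda>a. g (vs ! a)"])
qed

lemma pairs_refutedD:
  assumes "pairs_refuted cs ss" and "s \<in> set ss" and "t \<in> set ss"
  shows "\<exists>c\<in>set cs. refutes2 s t c \<or> refutes2 t s c"
  using assms
proof (induction ss)
  case (Cons x ss)
  then show ?case
    by (fastforce simp: list_all_iff list_ex_iff)
qed simp

text \<open>An outer vertex of an unlisted type, or two adjacent outer vertices with types of one
  colour, would satisfy a clause and thereby complete a forbidden pattern. So the colour classes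
  cover the graph and are stable.\<close>

theorem certificate_sound:
  assumes simple: "simple_graph V E"
    and F: "\<And>p. p \<in> set F \<Longrightarrow> \<not> occurs p V E"
    and cert: "certificate F H cls ws"
    and occ: "occurs H V E"
  shows "colourable E V (length cls)"
proof -
  obtain n es where H: "H = (n, es)"
    by (cases H)
  have sym: "\<And>x y. E x y \<Longrightarrow> E y x" and irrefl: "\<And>x. \<not> E x x"
    using simple unfolding simple_graph_def by blast+
  define cs where "cs = concat (map (\<lambda>(p, vss). map (clause_of n p) vss) ws)"
  define ts where "ts = concat (map (\<lambda>(K, S). map (vec n) S) cls)"
  have ws: "\<And>p vss vs. \<lbrakk>(p, vss) \<in> set ws; vs \<in> set vss\<rbrakk> \<Longrightarrow> p \<in> set F \<and> embedding_ok (n, es) p vs"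
    and cover_core: "\<And>i. i < n \<Longrightarrow> \<exists>(K, S) \<in> set cls. i \<in> set K"
    and cover: "covers n cs ts" and cls: "\<And>C. C \<in> set cls \<Longrightarrow> class_ok (n, es) cs C"
    using cert unfolding certificate_def H cs_def ts_def
    by (auto simp: Let_def list_all_iff list_ex_iff)
  obtain f where inj: "inj_on f {..<n}" and fV: "f ` {..<n} \<subseteq> V"
    and fE: "\<And>i j. \<lbrakk>i < n; j < n\<rbrakk> \<Longrightarrow> edges_of es i j = E (f i) (f j)"
    using occ unfolding H by (auto simp: induced_embeds_def)
  define type where "type u = map (\<lambda>i. E (f i) u) [0..<n]" for u
  have clauseE: "\<exists>p vs. p \<in> set F \<and> embedding_ok (n, es) p vs \<and> c = clause_of n p vs"
    if "c \<in> set cs" for c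
    using that ws unfolding cs_def by fastforce
  have occurs1: False if u: "u \<in> V" "u \<notin> f ` {..<n}" and c: "c \<in> set cs" "refutes1 (type u) c" for u c
  proof -
    obtain k hs vs where p: "(k, hs) \<in> set F" and ok: "embedding_ok (n, es) (k, hs) vs"
      and cl: "c = clause_of n (k, hs) vs"
      using clauseE[OF c(1)] by (metis surj_pair)
    \<comment> \<open>The refuting clause has no second component, so \<open>Suc n\<close> is not in
      \<open>vs\<close> and the value of \<open>g\<close> there does not matter.\<close>
    define g where "g = f(n := u)"
    have nv: "Suc n \<notin> set vs" and ag: "agrees (literals (k, hs) vs n n) (type u)"
      using c(2) unfolding cl clause_of_def by (auto split: if_splits)
    have vs: "set vs \<subseteq> {..<Suc n}"
    proof
      fix x assume x: "x \<in> set vs"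
      then have "x < n + 2"
        using ok by (simp add: list_all_iff)
      moreover have "x \<noteq> Suc n"
        using x nv by blast
      ultimately show "x \<in> {..<Suc n}"
        by simp
    qed
    have "occurs (k, hs) V E"
    proof (rule embedding_occurs[where g = g, OF ok])
      have "inj_on g {..<Suc n}"
        using inj u(2) unfolding g_def inj_on_def by (auto simp: less_Suc_eq)
      then show "inj_on g (set vs)"
        using vs by (rule inj_on_subset)
      have "g ` {..<Suc n} \<subseteq> V"
        using fV u(1) unfolding g_def by (auto simp: less_Suc_eq)
      then show "g ` set vs \<subseteq> V"
        using vs by blast
      have "map (\<lambda>i. E (g i) (g n)) [0..<n] = type u"
        unfolding type_def g_def by simp
      then show "agrees (literals (k, hs) vs n n) (map (\<lambda>i. E (g i) (g n)) [0..<n])"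
        using ag by simp
    qed (use sym irrefl fE nv in \<open>auto simp: g_def\<close>)
    then show False
      using F p by blast
  qed
  have occurs2: False
    if uv: "u \<in> V" "v \<in> V" "u \<notin> f ` {..<n}" "v \<notin> f ` {..<n}" "E u v"
      and c: "c \<in> set cs" "refutes2 (type u) (type v) c" for u v c
  proof -
    obtain k hs vs where p: "(k, hs) \<in> set F" and ok: "embedding_ok (n, es) (k, hs) vs"
      and cl: "c = clause_of n (k, hs) vs"
      using clauseE[OF c(1)] by (metis surj_pair)
    define g where "g = f(n := u, Suc n := v)"
    have ag: "agrees (literals (k, hs) vs n n) (type u)"
      and ag': "Suc n \<in> set vs \<Longrightarrow> agrees (literals (k, hs) vs n (Suc n)) (type v)"
      using c(2) unfolding cl clause_of_def by (auto split: if_splits)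
    have vs: "set vs \<subseteq> {..<n + 2}"
      using ok by (auto simp: list_all_iff)
    have "u \<noteq> v"
      using uv(5) irrefl by blast
    have "occurs (k, hs) V E"
    proof (rule embedding_occurs[where g = g, OF ok])
      have "inj_on g {..<n + 2}"
        using inj uv(3,4) \<open>u \<noteq> v\<close> unfolding g_def inj_on_def by (auto simp: less_Suc_eq)
      then show "inj_on g (set vs)"
        using vs by (rule inj_on_subset)
      have "g ` {..<n + 2} \<subseteq> V"
        using fV uv(1,2) unfolding g_def by (auto simp: less_Suc_eq)
      then show "g ` set vs \<subseteq> V"
        using vs by blast
      have "map (\<lambda>i. E (g i) (g n)) [0..<n] = type u"
        unfolding type_def g_def by simp
      then show "agrees (literals (k, hs) vs n n) (map (\<lambda>i. E (g i) (g n)) [0..<n])"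
        using ag by simp
      have "map (\<lambda>i. E (g i) (g (Suc n))) [0..<n] = type v"
        unfolding type_def g_def by simp
      then show "agrees (literals (k, hs) vs n (Suc n)) (map (\<lambda>i. E (g i) (g (Suc n))) [0..<n])"
        if "Suc n \<in> set vs"
        using ag' that by simp
    qed (use sym irrefl fE uv(5) in \<open>auto simp: g_def\<close>)
    then show False
      using F p by blast
  qed
  \<comment> \<open>Core vertices are placed by name, all others by type.\<close>
  define A where "A m = f ` set (fst (cls ! m)) \<union>
    {u \<in> V - f ` {..<n}. type u \<in> vec n ` set (snd (cls ! m))}" for m
  have "\<exists>m<length cls. u \<in> A m" if u: "u \<in> V" for u
  proof (cases "u \<in> f ` {..<n}")
    case True
    then obtain i where "i < n" "u = f i"
      by blast
    then show ?thesis
      using cover_core[of i] unfolding A_def by (fastforce simp: in_set_conv_nth)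
  next
    case False
    have "type u \<in> set (all_vecs n)"
      unfolding type_def by (rule member_all_vecs) simp
    then have "type u \<in> set ts \<or> (\<exists>c\<in>set cs. refutes1 (type u) c)"
      using cover unfolding covers_def by (simp add: list_all_iff list_ex_iff)
    then have "type u \<in> set ts"
      using occurs1[OF u False] by blast
    then obtain m where "m < length cls" "type u \<in> vec n ` set (snd (cls ! m))"
      unfolding ts_def by (fastforce simp: in_set_conv_nth)
    then show ?thesis
      using u False unfolding A_def by blast
  qed
  moreover have "stable_set E (A m)" if m: "m < length cls" for m
    unfolding stable_set_def
  proof (intro ballI notI)
    obtain K S where KS: "cls ! m = (K, S)"
      by (cases "cls ! m")
    have "class_ok (n, es) cs (K, S)"
      using cls[OF nth_mem[OF m]] unfolding KS .
    then have Kn: "\<And>i. i \<in> set K \<Longrightarrow> i < n"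
      and KK: "\<And>i j. \<lbrakk>i \<in> set K; j \<in> set K\<rbrakk> \<Longrightarrow> \<not> edges_of es i j"
      and KS': "\<And>i s. \<lbrakk>i \<in> set K; s \<in> set S\<rbrakk> \<Longrightarrow> i \<notin> set s"
      and SS: "pairs_refuted cs (map (vec n) S)"
      by (auto simp: list_all_iff)
    have mixed: "\<not> E (f i) v" if iv: "i \<in> set K" "type v \<in> vec n ` set S" for i v
    proof -
      obtain s where s: "s \<in> set S" "type v = vec n s"
        using iv(2) by blast
      have "type v ! i = (i \<in> set s)"
        using s Kn[OF iv(1)] by (simp add: vec_def)
      moreover have "type v ! i = E (f i) v"
        using Kn[OF iv(1)] by (simp add: type_def)
      ultimately show ?thesis
        using KS'[OF iv(1) s(1)] by simp
    qed
    fix u v assume "u \<in> A m" "v \<in> A m" and E: "E u v"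
    then consider (core) i j where "i \<in> set K" "j \<in> set K" "u = f i" "v = f j"
      | (left) i where "i \<in> set K" "u = f i" "type v \<in> vec n ` set S"
      | (right) i where "i \<in> set K" "v = f i" "type u \<in> vec n ` set S"
      | (none) "u \<in> V - f ` {..<n}" "v \<in> V - f ` {..<n}"
          "type u \<in> vec n ` set S" "type v \<in> vec n ` set S"
      unfolding A_def KS by auto
    then show False
    proof cases
      case core
      then show False
        using KK Kn fE E by blast
    next
      case left
      then show False
        using mixed E by blast
    next
      case right
      then show False
        using mixed E sym by blast
    next
      case none
      \<comment> \<open>The clause may fit the pair in either order; the edge \<open>E u v\<close>
        can be read both ways.\<close>
      then obtain c where c: "c \<in> set cs"
        "refutes2 (type u) (type v) c \<or> refutes2 (type v) (type u) c"
        using pairs_refutedD[OF SS, of "type u" "type v"] by auto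
      show False
        using c(2)
      proof
        assume "refutes2 (type u) (type v) c"
        then show False
          using occurs2[of u v c] none c(1) E by blast
      next
        assume "refutes2 (type v) (type u) c"
        then show False
          using occurs2[of v u c] none c(1) sym[OF E] by blast
      qed
    qed
  qed
  ultimately show ?thesis
    by (rule colourable_stable_cover)
qed

subsection \<open>The cores\<close>

text \<open>
  In the wheels, \<open>0, \<dots>, 4\<close> is the rim and \<open>5\<close> the hub; the suffixes are the neighbourhoods of the
  vertices \<open>6\<close> and \<open>7\<close>. The order matters: each core is coloured under the assumption that none of
  the previous ones occurs. Colourings and embeddings were found by computer search.
\<close>

definition p3_p2 :: pattern where
  "p3_p2 = (5, [(0,1),(1,2),(3,4)])"

definition k4 :: pattern where
  "k4 = (4, [(0,1),(0,2),(0,3),(1,2),(1,3),(2,3)])"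

definition codomino :: pattern where
  "codomino = (6, C6_edges @ [(1,3),(0,4)])"

definition co_A :: pattern where
  "co_A = (6, C6_edges @ [(1,3),(0,4),(0,3)])"

definition wheel_0123_14 :: pattern where
  "wheel_0123_14 = (8,
    [(0,1),(0,4),(0,5),(0,6),(1,2),(1,5),(1,6),(1,7),(2,3),(2,5),(2,6),(3,4),(3,5),(3,6),(4,5),
    (4,7)])"

text \<open>A finite check over all 256 types. For example, \<open>[9,8,6,2]\<close> under
  \<open>k4\<close> says that two adjacent outer vertices \<open>8\<close> and \<open>9\<close>
  cannot both be joined to the core edge between \<open>6\<close> and \<open>2\<close>.\<close>

lemma wheel_0123_14_certificate:
  "certificate [p3_p2, k4, codomino, co_A] wheel_0123_14
     [([3,7],[[1],[2,4],[0,2,4],[1,2,4],[0,1,2,4]]),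
      ([5,6],[[1,2,3,4],[0,1,2,3,4],[0,2,3,7],[0,1,2,3,7]]),
      ([2,4],[[],[0],[0,3],[1,3],[0,1,3],[0,3,6,7]]),
      ([0],[[4,6],[1,4,6],[1,3,4,6],[4,5,6],[1,4,5,6]]),
      ([1],[[2,4,6],[0,2,4,6],[0,2,5,6],[2,4,5,6],[0,2,4,6,7],[2,5,6,7],[0,2,5,6,7],[2,4,5,6,7]]),
      ([],[[0,3,5],[1,3,5],[3,5,6,7],[0,3,5,6,7],[1,3,5,6,7]]),
      ([],[[5],[0,5],[1,5],[0,2,5,7],[5,6,7]])]
     [(k4, [[9,8,6,2], [8,5,1,0], [8,6,3,2], [8,5,4,3], [9,8,5,3], [8,6,2,1], [9,8,3,2],
      [8,5,4,0], [8,6,1,0], [8,5,3,2], [9,8,5,4], [8,5,2,1], [9,8,6,1]]),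
      (p3_p2, [[4,5,2,9,8], [2,5,0,8,7], [8,2,6,7,4], [8,6,2,7,4], [6,3,5,9,8], [3,6,0,8,7],
      [7,8,0,3,2], [8,4,7,6,2], [4,3,2,9,8], [2,5,0,9,8], [8,7,4,6,2], [7,1,0,8,3], [6,0,5,8,7],
      [6,3,5,8,7], [6,3,4,9,8], [7,4,0,8,2], [3,5,0,8,7], [6,2,5,8,7]]),
      (co_A, [[5,4,8,0,1,2], [3,6,8,2,5,4], [5,9,8,4,3,2], [3,6,1,2,8,4], [5,1,8,0,4,3],
      [5,1,6,0,4,8], [8,2,6,1,7,4], [5,8,7,1,2,3], [8,1,2,6,9,4]]),
      (codomino, [[8,6,2,3,4,7], [9,6,3,2,8,7]])]"
  by code_simp

definition wheel_0123_0124 :: pattern where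
  "wheel_0123_0124 = (8,
    [(0,1),(0,4),(0,5),(0,6),(0,7),(1,2),(1,5),(1,6),(1,7),(2,3),(2,5),(2,6),(2,7),(3,4),(3,5),
    (3,6),(4,5),(4,7)])"

lemma wheel_0123_0124_certificate:
  "certificate [p3_p2, k4, codomino, co_A, wheel_0123_14] wheel_0123_0124
     [([4],[[2],[0,2],[1,5],[2,5],[0,2,5],[0,2,5,6],[2,5,7],[0,2,5,7],[1,5,6,7],[2,5,6,7],
     [0,2,5,6,7]]),
      ([5,6,7],[[0,1,2,3],[1,2,4],[0,1,2,4],[1,3,4],[0,1,2,3,4]]),
      ([0,2],[[1],[4],[1,4,5,6],[1,3,5,7],[1,3,4,6,7],[1,3,5,6,7],[1,4,5,6,7]]),
      ([1,3],[[],[5],[0,5],[5,6],[0,5,6],[4,5,6],[5,7],[6,7],[4,6,7],[5,6,7],[0,5,6,7],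
      [4,5,6,7]]),
      ([],[[0,2,4],[4,6],[2,4,6],[0,2,4,6],[2,4,5,6],[2,4,6,7],[2,4,5,6,7]]),
      ([],[[3],[0,2,3],[3,7],[0,3,7],[0,2,3,7],[3,5,7],[0,3,5,7],[3,6,7],[0,3,6,7],[3,5,6,7],
      [0,3,5,6,7]]),
      ([],[[0],[0,1,3],[1,4,6],[1,3,7]])]
     [(p3_p2, [[3,2,1,9,8], [4,5,1,9,8], [3,5,1,9,8], [7,4,5,8,6], [6,3,5,8,7], [6,2,5,9,8],
      [8,9,1,4,3], [9,8,1,4,3], [2,5,0,9,8], [2,6,0,9,8], [7,2,5,9,8]]),
      (k4, [[8,5,1,0], [9,8,5,2], [8,6,3,2], [8,7,4,0], [8,5,4,3], [8,7,2,1], [9,8,5,3],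
      [9,8,6,1], [9,8,2,1], [9,8,6,2], [8,5,2,1], [8,6,1,0], [8,5,3,2], [8,5,4,0], [9,8,5,1],
      [8,6,2,1], [8,7,1,0], [9,8,7,0], [9,8,7,1], [9,8,4,3]]),
      (co_A, [[5,9,8,3,2,1], [6,3,8,2,1,0], [7,4,8,0,1,2], [5,9,8,2,3,4], [5,4,8,3,2,1],
      [5,1,7,2,3,8], [5,1,6,0,4,8], [6,9,8,3,2,1], [5,1,8,0,4,3], [5,2,8,1,0,4], [1,8,4,0,6,2],
      [5,0,7,4,3,8], [5,2,6,3,4,8], [1,5,4,0,6,8], [3,6,8,2,5,4], [8,2,6,1,9,4], [5,9,8,4,0,1],
      [9,6,1,2,8,4], [2,7,0,1,8,3], [4,7,1,0,8,3], [1,7,4,0,6,8], [6,0,7,1,8,3], [2,7,8,1,5,3],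
      [2,7,8,1,6,3], [7,2,6,1,8,4], [7,9,8,1,0,4], [6,9,8,1,2,3], [8,0,7,1,9,3], [9,7,1,0,8,3],
      [8,0,1,7,9,3]]),
      (codomino, [[7,2,8,6,0,4], [7,2,3,5,0,8], [7,2,3,6,0,8], [9,6,2,3,4,8], [9,7,1,0,8,3]]),
      (wheel_0123_14, [[4,0,1,2,3,5,7,8], [2,1,0,4,3,5,7,8], [0,1,2,3,4,5,6,8], [3,2,1,0,4,5,6,8],
      [3,9,1,0,4,5,6,8]])]"
  by code_simp

definition wheel_0123 :: pattern where
  "wheel_0123 = (7,
    [(0,1),(0,4),(0,5),(0,6),(1,2),(1,5),(1,6),(2,3),(2,5),(2,6),(3,4),(3,5),(3,6),(4,5)])"

lemma wheel_0123_certificate: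
  "certificate [p3_p2, k4, codomino, co_A, wheel_0123_14, wheel_0123_0124] wheel_0123
     [([],[[1,2,4],[1,4,6],[2,4,6],[1,4,5,6],[2,4,5,6]]),
      ([6],[[0],[1],[0,3],[0,1,3],[1,3,4],[0,3,5]]),
      ([5],[[0,2,3],[0,1,2,3],[0,1,2,3,4]]),
      ([1,3],[[2],[0,2],[0,2,4],[0,5],[2,5],[0,2,5],[0,2,5,6]]),
      ([0],[[3],[1,3],[3,5],[1,3,5],[2,5,6],[3,5,6],[1,3,5,6]]),
      ([],[[4],[0,6],[3,6],[0,3,6],[4,6],[0,2,4,6],[1,3,4,6],[0,3,5,6],[4,5,6]]),
      ([2,4],[[],[5],[1,5],[6],[5,6],[0,5,6],[1,5,6]])]
     [(p3_p2, [[4,3,2,8,7], [3,6,1,8,7], [2,5,0,8,7], [3,5,1,8,7], [7,8,4,2,1], [3,5,0,8,7],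
      [7,8,2,4,0], [3,2,1,8,7], [6,2,5,8,7], [8,7,4,2,1], [8,7,2,4,0], [8,7,4,6,2]]),
      (k4, [[7,5,1,0], [7,6,3,2], [8,7,5,3], [7,5,4,3], [7,6,1,0], [8,7,3,2], [7,5,2,1],
      [8,7,5,2], [7,5,4,0], [8,7,6,0], [8,7,6,3], [8,7,6,1], [7,5,3,2], [7,6,2,1], [8,7,6,2],
      [8,7,5,4], [8,7,5,0]]),
      (co_A, [[5,8,7,3,4,0], [5,4,7,0,1,2], [5,2,7,1,0,4], [6,3,7,2,1,0], [5,1,7,0,4,3],
      [1,7,4,0,6,2], [5,4,7,3,2,1], [5,1,6,0,4,7], [1,5,4,0,6,7], [3,6,7,2,5,4], [5,8,7,0,1,2],
      [5,8,7,2,3,4], [3,6,1,2,7,4], [5,2,6,3,4,7], [1,7,8,0,6,2], [6,2,5,3,8,7], [6,1,5,2,8,7],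
      [7,2,1,6,8,4], [7,1,2,6,8,4]]),
      (wheel_0123_14, [[0,1,2,3,4,5,6,7], [3,2,1,0,4,5,6,7], [0,1,2,3,8,5,6,7]]),
      (wheel_0123_0124, [[2,1,0,4,3,5,7,6], [3,2,1,0,4,5,6,7], [8,1,2,3,4,5,6,7],
      [8,2,1,0,4,5,6,7], [6,2,5,4,7,8,3,1], [6,1,5,4,7,8,0,2], [2,8,0,4,3,5,7,6],
      [7,6,1,5,4,0,2,8]])]"
  by code_simp

definition wheel_013 :: pattern where
  "wheel_013 = (7,
    [(0,1),(0,4),(0,5),(0,6),(1,2),(1,5),(1,6),(2,3),(2,5),(3,4),(3,5),(3,6),(4,5)])"

lemma wheel_013_certificate:
  "certificate [p3_p2, k4, codomino, co_A, wheel_0123_14, wheel_0123_0124, wheel_0123] wheel_013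
     [([],[[],[5],[1,5],[1,3,5],[2,6],[1,5,6],[2,5,6]]),
      ([5],[[0,3],[1,3],[0,1,3],[0,1,2,3,4],[0,2,6],[0,2,3,6],[1,3,4,6]]),
      ([4,6],[[3],[0,2,3],[3,5],[0,3,5]]),
      ([0],[[1],[1,4],[1,2,4],[1,3,4],[1,4,5],[4,6],[1,4,6],[1,4,5,6]]),
      ([3],[[2,4],[2,4,6],[0,2,4,6],[1,2,4,6],[2,4,5,6]]),
      ([1],[[0],[0,2],[0,2,4],[0,5],[0,2,5],[0,2,5,6]]),
      ([2],[[5,6],[0,5,6],[3,5,6],[4,5,6]])]
     [(p3_p2, [[3,5,0,8,7], [3,4,0,8,7], [3,6,1,8,7], [2,5,0,8,7], [6,1,2,7,4], [4,5,2,7,6],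
      [4,5,1,8,7], [2,1,0,8,7], [6,0,4,7,2], [4,5,2,8,7], [7,8,6,5,4], [3,5,1,8,7], [3,2,1,8,7],
      [6,1,2,8,7], [6,0,4,8,7], [7,8,2,4,0], [7,8,6,5,2], [8,7,2,6,0]]),
      (k4, [[7,5,1,0], [7,5,3,2], [7,6,1,0], [8,7,5,1], [8,7,5,0], [7,5,4,0], [7,5,2,1],
      [7,5,4,3], [8,7,1,0], [8,7,5,2], [8,7,3,2], [8,7,4,3], [8,7,6,3]]),
      (co_A, [[5,8,7,1,2,3], [5,3,7,2,1,0], [5,1,7,0,4,3], [5,2,7,1,0,4], [5,4,7,0,1,2],
      [5,8,7,2,1,0], [5,7,8,4,3,2], [5,8,7,0,4,3], [5,0,7,1,2,3], [5,4,7,3,2,1], [5,0,6,1,2,7],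
      [8,4,5,3,6,7]]),
      (wheel_0123, [[2,3,4,0,1,5,7], [4,3,2,1,0,5,7], [3,4,8,1,2,5,7], [3,2,1,0,4,5,7],
      [4,0,1,2,3,5,7], [3,4,0,1,2,5,7], [3,7,0,1,2,5,6], [3,7,1,0,4,5,6], [3,2,1,0,7,8,5],
      [3,4,0,1,7,8,5], [2,3,4,0,8,7,5], [2,3,8,0,1,5,7], [4,8,1,2,3,5,7], [2,8,6,0,5,1,7],
      [2,8,4,0,1,5,7], [4,8,2,1,0,5,7], [4,0,8,2,3,5,7], [3,8,7,0,4,5,6]]),
      (codomino, [[7,0,1,6,3,8], [8,5,2,3,6,7]])]"
  by code_simp

definition wheel :: pattern where
  "wheel = (6,
    [(0,1),(0,4),(0,5),(1,2),(1,5),(2,3),(2,5),(3,4),(3,5),(4,5)])"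

lemma wheel_certificate:
  "certificate [p3_p2, k4, codomino, co_A, wheel_0123_14, wheel_0123_0124, wheel_0123, wheel_013] wheel
     [([0],[[],[1],[5],[1,5]]),
      ([5],[[1,4],[2,4],[0,1,2,3,4]]),
      ([1,3],[[2],[0,2],[2,5],[0,2,5],[2,4,5]]),
      ([2,4],[[3],[0,3],[1,3],[3,5],[0,3,5],[1,3,5]]),
      ([],[[0,5],[4,5],[1,4,5]]),
      ([],[[0]]),
      ([],[[4]])]
     [(p3_p2, [[3,4,0,7,6], [4,5,2,7,6], [3,5,0,7,6], [3,2,1,7,6], [3,5,1,7,6], [7,6,0,3,2]]),
      (k4, [[6,5,1,0], [6,5,3,2], [7,6,5,3], [7,6,5,2], [6,5,4,0], [6,5,2,1], [6,5,4,3],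
      [7,6,5,4], [7,6,1,0]]),
      (co_A, [[5,7,6,3,2,1], [5,7,6,2,3,4], [5,7,6,3,4,0], [5,1,6,0,4,3], [5,2,6,1,0,4],
      [5,3,6,2,1,0], [5,4,6,0,1,2], [5,0,6,1,2,3], [5,4,6,3,2,1], [5,7,6,2,1,0]]),
      (wheel_0123, [[3,2,1,0,4,5,6], [4,0,1,2,3,5,6], [3,4,0,1,2,5,6], [2,3,4,0,1,5,6],
      [4,3,2,1,0,5,6], [4,3,2,1,6,7,5], [4,0,1,2,6,7,5]]),
      (wheel_013, [[1,0,4,3,2,5,6], [3,2,1,0,4,5,6], [4,0,1,2,3,5,6], [2,1,0,4,3,5,6],
      [4,3,2,1,0,5,6], [7,2,1,0,4,5,6], [7,3,4,0,1,5,6], [7,3,2,1,0,5,6]])]"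
  by code_simp

text \<open>\<open>0, 1, 2\<close> is the triangle \<open>abc\<close>; the edge \<open>34\<close> is
  private to \<open>0\<close> and the edge \<open>56\<close> to \<open>1\<close>. The adjacencies
  between these two edges form the path \<open>5, 3, 6, 4\<close>.\<close>

definition triangles_path :: pattern where
  "triangles_path = (7,
    [(0,1),(0,2),(0,3),(0,4),(1,2),(1,5),(1,6),(3,4),(3,5),(3,6),(4,6),(5,6)])"

lemma triangles_path_certificate:
  "certificate [p3_p2, k4, codomino, co_A, wheel_0123_14, wheel_0123_0124, wheel_0123, wheel_013, wheel] triangles_path
     [([0],[[1,3],[2,3,5]]),
      ([4,5],[[0,1,3,6],[2,3,6]]),
      ([],[[],[0,6],[2,4,6]]),
      ([2,6],[[1,4],[1,3,4]]),
      ([1,3],[[0,5,6],[2,4,5,6],[0,2,4,5,6]]),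
      ([],[[0,5],[0,1,4,5],[2,4,5]]),
      ([],[[2,3,4,5],[1,2,3,4,5]])]
     [(k4, [[7,2,1,0], [7,6,4,3], [7,6,5,1], [8,7,6,5], [7,4,3,0], [8,7,6,3], [7,6,5,3],
      [8,7,1,0], [8,7,4,3]]),
      (p3_p2, [[7,0,2,6,5], [7,2,0,6,5], [7,5,6,2,0], [7,2,1,4,3], [7,3,4,2,1], [7,4,3,2,1],
      [3,5,1,8,7], [7,1,2,4,3], [7,6,5,2,0], [3,6,1,8,7], [6,4,0,8,7], [5,1,2,7,4], [4,0,2,7,5],
      [5,3,0,8,7], [7,8,2,6,3]]),
      (co_A, [[3,7,2,0,4,6], [4,7,2,0,3,6], [5,7,2,1,6,3], [6,7,2,1,5,3], [7,6,5,3,0,2],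
      [7,3,4,6,1,2], [4,6,5,3,8,7], [4,8,7,0,3,6]]),
      (codomino, [[7,3,4,6,1,2], [7,6,5,3,0,2]]),
      (wheel_0123, [[6,5,7,0,4,3,1], [3,4,7,1,5,6,0]])]"
  by code_simp

text \<open>As for \<open>triangles_path\<close>, but the two private edges are joined only by the
  matching \<open>35, 46\<close>.\<close>

definition triangles_matching :: pattern where
  "triangles_matching = (7,
    [(0,1),(0,2),(0,3),(0,4),(1,2),(1,5),(1,6),(3,4),(3,5),(4,6),(5,6)])"

lemma triangles_matching_certificate:
  "certificate [p3_p2, k4, codomino, co_A, wheel_0123_14, wheel_0123_0124, wheel_0123, wheel_013, wheel, triangles_path] triangles_matching
     [([],[[0,1,3,5],[0,1,4,5],[0,1,3,6],[0,1,4,6],[2,3,4,5,6]]),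
      ([5],[[1,3],[1,3,4],[1,2,3,6],[1,2,3,4,6]]),
      ([0,6],[[1,4],[1,2,4,5],[1,2,3,4,5]]),
      ([2,3],[[],[0,5]]),
      ([1,4],[[0,6],[0,2,3,6],[0,5,6],[0,2,3,5,6]]),
      ([],[[2,3,5],[2,4,5],[0,2,4,5],[2,3,4,5],[2,4,5,6]]),
      ([],[[2,3,6],[2,4,6],[2,3,4,6],[2,3,5,6],[0,2,4,5,6]])]
     [(k4, [[7,2,1,0], [7,4,3,0], [7,6,5,1], [8,7,6,4], [8,7,1,0], [8,7,6,5], [8,7,2,1],
      [8,7,2,0], [8,7,4,3], [8,7,5,3]]),
      (p3_p2, [[7,2,0,6,5], [7,3,4,2,1], [7,4,3,2,1], [7,2,1,4,3], [6,1,0,8,7], [7,1,2,4,3],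
      [7,5,6,2,0], [7,6,5,2,0], [7,0,2,6,5], [5,1,0,8,7], [4,6,1,8,7], [6,4,3,7,2], [6,5,3,7,2],
      [5,3,4,7,2], [5,6,4,7,2], [6,1,2,7,3], [4,0,2,7,5], [6,4,0,8,7], [5,3,0,8,7], [3,5,1,8,7],
      [7,8,3,6,1]]),
      (triangles_path, [[2,1,0,8,7,6,5], [2,1,0,8,7,5,6], [5,1,6,8,7,0,2], [5,1,6,7,3,2,0],
      [3,0,4,7,5,2,1], [6,1,5,7,4,2,0], [4,0,3,7,6,2,1], [1,0,2,8,7,4,3], [3,0,4,8,7,2,1],
      [4,0,3,8,7,2,1], [6,1,5,8,7,2,0], [1,0,2,6,5,7,8]]),
      (codomino, [[5,1,2,0,3,7]]),
      (co_A, [[8,3,4,7,1,2], [8,0,2,7,6,5], [8,2,0,7,5,6]]),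
      (wheel_0123_0124, [[5,8,4,0,1,7,3,6], [6,8,3,0,1,7,4,5]]),
      (wheel_013, [[6,1,7,3,4,8,5], [5,1,7,4,3,8,6], [3,0,7,6,5,8,4], [2,0,4,6,7,8,1]])]"
  by code_simp

subsection \<open>Graphs without cores\<close>

lemma occurs_list:
  assumes "distinct xs" and "set xs \<subseteq> V" and "length xs = k"
    and "\<And>i j. \<lbrakk>i < k; j < k\<rbrakk> \<Longrightarrow> edges_of hs i j = E (xs ! i) (xs ! j)"
  shows "occurs (k, hs) V E"
proof -
  have "inj_on (nth xs) {..<k}"
    using assms(1,3) by (simp add: inj_on_nth)
  moreover have "nth xs ` {..<k} \<subseteq> V"
    using assms(2,3) by auto
  ultimately show ?thesis
    using assms(4) by (auto simp: induced_embeds_def intro!: exI[of _ "nth xs"])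
qed

locale triangles_sparse =
  fixes V :: "'a set" and E :: "'a \<Rightarrow> 'a \<Rightarrow> bool"
  assumes simple: "simple_graph V E"
    and no_p3_p2: "\<not> occurs p3_p2 V E"
    and no_k4: "\<not> occurs k4 V E"
    and no_co_A: "\<not> occurs co_A V E"
    and no_matching: "\<not> occurs triangles_matching V E"
    and no_path: "\<not> occurs triangles_path V E"
begin

lemma fin: "finite V" and sym: "E x y \<Longrightarrow> E y x" and irrefl: "\<not> E x x"
  and in_V: "E x y \<Longrightarrow> x \<in> V" "E x y \<Longrightarrow> y \<in> V"
  using simple unfolding simple_graph_def by blast+

text \<open>Among the inequalities only \<open>p \<noteq> r\<close> has to be demanded: adjacent
  vertices differ, and each of \<open>p, q, r\<close> has a neighbour on the path that
  \<open>s\<close> and \<open>t\<close> miss.\<close>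

lemma p3_p2:
  assumes "E p q" "E q r" "\<not> E p r" "p \<noteq> r" "E s t"
    and "\<not> E p s" "\<not> E p t" "\<not> E q s" "\<not> E q t" "\<not> E r s" "\<not> E r t"
  shows False
proof -
  have "occurs p3_p2 V E"
    unfolding p3_p2_def
  proof (rule occurs_list[where xs = "[p, q, r, s, t]"])
    show "distinct [p, q, r, s, t]"
      using assms irrefl sym by auto
    show "set [p, q, r, s, t] \<subseteq> V"
      using assms in_V by auto
    have "\<forall>i<5. \<forall>j<5. edges_of [(0,1),(1,2),(3,4)] i j = E ([p, q, r, s, t] ! i) ([p, q, r, s, t] ! j)"
      using assms irrefl sym by (auto simp: edges_of_def less_Suc_eq numeral_eq_Suc)
    then show "\<And>i j. \<lbrakk>i < 5; j < 5\<rbrakk> \<Longrightarrow>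
        edges_of [(0,1),(1,2),(3,4)] i j = E ([p, q, r, s, t] ! i) ([p, q, r, s, t] ! j)"
      by blast
  qed simp
  then show False
    using no_p3_p2 by blast
qed

lemma k4:
  assumes "E p q" "E p r" "E p s" "E q r" "E q s" "E r s"
  shows False
proof -
  have "occurs k4 V E"
    unfolding k4_def
  proof (rule occurs_list[where xs = "[p, q, r, s]"])
    show "distinct [p, q, r, s]"
      using assms irrefl by auto
    show "set [p, q, r, s] \<subseteq> V"
      using assms in_V by auto
    have "\<forall>i<4. \<forall>j<4. edges_of [(0,1),(0,2),(0,3),(1,2),(1,3),(2,3)] i j
        = E ([p, q, r, s] ! i) ([p, q, r, s] ! j)"
      using assms irrefl sym by (auto simp: edges_of_def less_Suc_eq numeral_eq_Suc)
    then show "\<And>i j. \<lbrakk>i < 4; j < 4\<rbrakk> \<Longrightarrow> edges_of [(0,1),(0,2),(0,3),(1,2),(1,3),(2,3)] i j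
        = E ([p, q, r, s] ! i) ([p, q, r, s] ! j)"
      by blast
  qed simp
  then show False
    using no_k4 by blast
qed

text \<open>The 6-cycle is \<open>z, b, c, a, p, x\<close> with chords \<open>ba\<close>,
  \<open>zp\<close>, \<open>za\<close>. The names fit the later use: \<open>abc\<close> is a
  triangle, \<open>z\<close> sees \<open>a\<close> and \<open>b\<close>, \<open>p\<close> is private
  to \<open>a\<close>, and \<open>x\<close> misses the triangle.\<close>

lemma co_A:
  assumes "E z b" "E b c" "E c a" "E a p" "E p x" "E x z" "E b a" "E z p" "E z a"
    and "\<not> E z c" "\<not> E b p" "\<not> E b x" "\<not> E c p" "\<not> E c x" "\<not> E a x"
  shows False
proof -
  let ?xs = "[z, b, c, a, p, x]"
  have "occurs co_A V E"
    unfolding co_A_def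
  proof (rule occurs_list[where xs = ?xs])
    show "distinct ?xs"
      using assms irrefl sym by auto
    show "set ?xs \<subseteq> V"
      using assms in_V by auto
    have "\<forall>i<6. \<forall>j<6. edges_of (C6_edges @ [(1,3),(0,4),(0,3)]) i j = E (?xs ! i) (?xs ! j)"
      using assms irrefl sym by (auto simp: edges_of_def C6_edges_def less_Suc_eq numeral_eq_Suc)
    then show "\<And>i j. \<lbrakk>i < 6; j < 6\<rbrakk> \<Longrightarrow>
        edges_of (C6_edges @ [(1,3),(0,4),(0,3)]) i j = E (?xs ! i) (?xs ! j)"
      by blast
  qed simp
  then show False
    using no_co_A by blast
qed

text \<open>Only the adjacency of \<open>p\<close> and \<open>s\<close> is left open. If it is
  present, the edges between \<open>pq\<close> and \<open>rs\<close> form a path, otherwise a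
  matching; either way a core appears.\<close>

lemma two_triangles:
  assumes "E a b" "E a c" "E b c" "E a p" "E a q" "E p q" "E b r" "E b s" "E r s" "E p r" "E q s"
    and "\<not> E b p" "\<not> E b q" "\<not> E c p" "\<not> E c q" "\<not> E a r" "\<not> E a s" "\<not> E c r" "\<not> E c s"
    and "\<not> E q r"
  shows False
proof -
  let ?xs = "[a, b, c, p, q, r, s]"
  let ?M = "[(0,1),(0,2),(0,3),(0,4),(1,2),(1,5),(1,6),(3,4),(3,5),(4,6),(5,6)] :: (nat \<times> nat) list"
  let ?P = "[(0,1),(0,2),(0,3),(0,4),(1,2),(1,5),(1,6),(3,4),(3,5),(3,6),(4,6),(5,6)] :: (nat \<times> nat) list"
  have dist: "distinct ?xs"
    using assms irrefl sym by auto
  have V: "set ?xs \<subseteq> V"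
    using assms in_V by auto
  show False
  proof (cases "E p s")
    case True
    have "\<forall>i<7. \<forall>j<7. edges_of ?P i j = E (?xs ! i) (?xs ! j)"
      using assms True irrefl sym by (auto simp: edges_of_def less_Suc_eq numeral_eq_Suc)
    then have "occurs triangles_path V E"
      unfolding triangles_path_def using dist V by (intro occurs_list[where xs = ?xs]) auto
    then show False
      using no_path by blast
  next
    case False
    have "\<forall>i<7. \<forall>j<7. edges_of ?M i j = E (?xs ! i) (?xs ! j)"
      using assms False irrefl sym by (auto simp: edges_of_def less_Suc_eq numeral_eq_Suc)
    then have "occurs triangles_matching V E"
      unfolding triangles_matching_def using dist V by (intro occurs_list[where xs = ?xs]) auto
    then show False
      using no_matching by blast
  qed
qed

text \<open>The path \<open>p, a, c\<close> and the edge \<open>rs\<close> would induce P3 \<union>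
  P2 unless \<open>p\<close> sees \<open>r\<close> or \<open>s\<close>; likewise for
  \<open>q, r, s\<close>. Not all four cross edges exist, by K4-freeness. Hence there is a perfect
  matching between \<open>pq\<close> and \<open>rs\<close> and a missing edge, the situation of
  \<open>two_triangles\<close> up to renaming.\<close>

lemma edge_in_one_part:
  assumes T: "E a b" "E a c" "E b c"
    and p: "E a p" "\<not> E b p" "\<not> E c p" and q: "E a q" "\<not> E b q" "\<not> E c q" and pq: "E p q"
    and r: "E b r" "\<not> E a r" "\<not> E c r" and s: "E b s" "\<not> E a s" "\<not> E c s" and rs: "E r s"
  shows False
proof -
  have pp: "E p r \<or> E p s"
    using p3_p2[of p a c r s] assms irrefl sym by metis
  have qq: "E q r \<or> E q s"
    using p3_p2[of q a c r s] assms irrefl sym by metis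
  have rr: "E r p \<or> E r q"
    using p3_p2[of r b c p q] assms irrefl sym by metis
  have ss: "E s p \<or> E s q"
    using p3_p2[of s b c p q] assms irrefl sym by metis
  have "\<not> (E p r \<and> E p s \<and> E q r \<and> E q s)"
    using k4[of p q r s] pq rs by blast
  then consider "E p r" "E q s" "\<not> E q r" | "E p r" "E q s" "\<not> E p s"
    | "E p s" "E q r" "\<not> E q s" | "E p s" "E q r" "\<not> E p r"
    using pp qq rr ss sym by metis
  then show False
  proof cases
    case 1 then show ?thesis using two_triangles[of a b c p q r s] assms by blast
  next
    case 2 then show ?thesis using two_triangles[of a b c q p s r] assms sym by blast
  next
    case 3 then show ?thesis using two_triangles[of a b c p q s r] assms sym by blast
  next
    case 4 then show ?thesis using two_triangles[of a b c q p r s] assms sym by blast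
  qed
qed

section \<open>Colourings relative to an edge or a triangle\<close>

lemma clique_card_le_3:
  assumes "K \<subseteq> V" "clique E K"
  shows "card K \<le> 3"
proof (rule ccontr)
  assume "\<not> card K \<le> 3"
  then obtain L where L: "L \<subseteq> K" "card L = 4"
    using obtain_subset_with_card_n[of 4 K] by auto
  then obtain p q r s where "L = {p, q, r, s}" "distinct [p, q, r, s]"
    by (auto simp: card_Suc_eq numeral_eq_Suc)
  then show False
    using L(1) assms(2) k4[of p q r s] unfolding clique_def by auto
qed

text \<open>An induced P3 in \<open>S\<close> would form P3 \<union> P2 with the edge
  \<open>e e'\<close>.\<close>

lemma colourable_anticomplete_edge:
  assumes S: "S \<subseteq> V" and e: "E e e'" "\<And>x. x \<in> S \<Longrightarrow> \<not> E x e \<and> \<not> E x e'"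
    and small: "\<And>K. \<lbrakk>K \<subseteq> S; clique E K\<rbrakk> \<Longrightarrow> card K \<le> k"
  shows "colourable E S k"
proof (rule colourable_cliques)
  show "finite S"
    using S fin by (rule finite_subset)
  fix x y z assume "x \<in> S" "y \<in> S" "z \<in> S" "E x y" "E y z" "x \<noteq> z"
  then show "E x z"
    using p3_p2[of x y z e e'] e by blast
qed (use sym irrefl small in auto)

lemma clique_card_le_2:
  assumes "\<And>x y z. \<lbrakk>x \<in> S; y \<in> S; z \<in> S; E x y; E x z; E y z\<rbrakk> \<Longrightarrow> False"
    and "K \<subseteq> S" "clique E K"
  shows "card K \<le> 2"
proof (rule ccontr)
  assume "\<not> card K \<le> 2"
  then obtain L where L: "L \<subseteq> K" "card L = 3"
    using obtain_subset_with_card_n[of 3 K] by auto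
  then obtain x y z where "L = {x, y, z}" "distinct [x, y, z]"
    by (auto simp: card_Suc_eq numeral_eq_Suc)
  then have "x \<in> K" "y \<in> K" "z \<in> K" "E x y" "E x z" "E y z"
    using L(1) assms(3) unfolding clique_def by auto
  then show False
    using assms(1,2) by blast
qed

text \<open>Around an edge \<open>ab\<close>, both neighbourhoods are stable and the common
  non-neighbours form cliques of at most two vertices.\<close>

lemma colourable_triangle_free:
  assumes "\<And>x y z. \<lbrakk>E x y; E x z; E y z\<rbrakk> \<Longrightarrow> False"
  shows "colourable E V 4"
proof (cases "\<exists>a b. E a b")
  case True
  then obtain a b where ab: "E a b"
    by blast
  have "colourable E {x \<in> V. \<not> E x a \<and> \<not> E x b} 2"
    by (rule colourable_anticomplete_edge[OF _ ab])
      (use clique_card_le_2[of "{x \<in> V. \<not> E x a \<and> \<not> E x b}"] assms in blast)+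
  moreover have "colourable E {x. E x a} 1" "colourable E {x. E x b} 1"
    using assms sym unfolding stable_set_def by (intro colourable_stable; auto simp: stable_set_def)+
  ultimately have "colourable E ({x \<in> V. \<not> E x a \<and> \<not> E x b} \<union> {x. E x a} \<union> {x. E x b}) (2 + 1 + 1)"
    by (intro colourable_Un)
  then show ?thesis
    by (rule colourable_mono) auto
next
  case False
  then have "colourable E V 1"
    by (intro colourable_stable) (simp add: stable_set_def)
  then show ?thesis
    by (rule colourable_mono) auto
qed

lemma colourable_around_triangle:
  assumes T: "E a b" "E a c" "E b c"
    and b_stable: "\<And>p q. \<lbrakk>E b p; E b q; \<not> E a p; \<not> E a q; \<not> E c p; \<not> E c q\<rbrakk> \<Longrightarrow> \<not> E p q"
    and c_stable: "\<And>p q. \<lbrakk>E c p; E c q; \<not> E a p; \<not> E a q; \<not> E b p; \<not> E b q\<rbrakk> \<Longrightarrow> \<not> E p q"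
  shows "colourable E V 7"
proof -
  \<comment> \<open>The triangle is included: \<open>a\<close>, \<open>b\<close>, \<open>c\<close>
    lie in \<open>?Nbc\<close>, \<open>?Nac\<close>, \<open>?Nab\<close> respectively.\<close>
  define N where "N i j k = {v \<in> V. E a v = i \<and> E b v = j \<and> E c v = k}" for i j k
  let ?N0 = "N False False False"
  let ?Na = "N True False False" let ?Nb = "N False True False" let ?Nc = "N False False True"
  let ?Nab = "N True True False" let ?Nac = "N True False True" let ?Nbc = "N False True True"
  have V: "V \<subseteq> ?N0 \<union> ?Na \<union> ?Nb \<union> ?Nc \<union> ?Nab \<union> ?Nac \<union> ?Nbc"
    using k4[of a b c] T unfolding N_def by blast
  have NV: "N i j k \<subseteq> V" for i j k
    unfolding N_def by blast
  have "stable_set E ?Nab" "stable_set E ?Nac" "stable_set E ?Nbc" "stable_set E ?Nb" "stable_set E ?Nc"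
    using k4[of a b] k4[of a c] k4[of b c] T b_stable c_stable unfolding stable_set_def N_def by blast+
  then have ab: "colourable E ?Nab 1" and ac: "colourable E ?Nac 1" and bc: "colourable E ?Nbc 1"
    and b1: "colourable E ?Nb 1" and c1: "colourable E ?Nc 1"
    by (blast intro: colourable_stable)+
  have a0: "colourable E S k"
    if "S \<subseteq> ?N0 \<union> ?Na" "\<And>K. \<lbrakk>K \<subseteq> S; clique E K\<rbrakk> \<Longrightarrow> card K \<le> k" for S k
    by (rule colourable_anticomplete_edge[OF _ T(3)])
      (use that sym in \<open>auto simp: N_def\<close>)
  \<comment> \<open>If \<open>?N0\<close> is stable, a triangle in \<open>?N0 \<union> ?Na\<close>
    has exactly one vertex in \<open>?N0\<close>, as three in \<open>?Na\<close> would give a K4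
    with \<open>a\<close>.\<close>
  consider (edge) x y where "x \<in> ?N0" "y \<in> ?N0" "E x y"
    | (tri) x p q where "stable_set E ?N0" "x \<in> ?N0" "p \<in> ?Na" "q \<in> ?Na" "E x p" "E x q" "E p q"
    | (none) "\<And>x y z. \<lbrakk>x \<in> ?N0 \<union> ?Na; y \<in> ?N0 \<union> ?Na; z \<in> ?N0 \<union> ?Na; E x y; E x z; E y z\<rbrakk> \<Longrightarrow> False"
  proof (cases "stable_set E ?N0")
    case False
    then show ?thesis
      using edge unfolding stable_set_def by blast
  next
    case True
    have "\<exists>x p q. x \<in> ?N0 \<and> p \<in> ?Na \<and> q \<in> ?Na \<and> E x p \<and> E x q \<and> E p q"
      if "x \<in> ?N0 \<union> ?Na" "y \<in> ?N0 \<union> ?Na" "z \<in> ?N0 \<union> ?Na" "E x y" "E x z" "E y z" for x y z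
    proof -
      have "\<not> (x \<in> ?Na \<and> y \<in> ?Na \<and> z \<in> ?Na)"
        using k4[of a x y z] that unfolding N_def by blast
      then show ?thesis
        using that True sym unfolding stable_set_def by (metis Un_iff)
    qed
    then show ?thesis
      using none tri True by blast
  qed
  then show ?thesis
  proof cases
    case edge
    \<comment> \<open>Let \<open>u\<close> be private to \<open>d\<close>. The path
      \<open>u, d, e\<close> forces \<open>u\<close> to see one end of \<open>xy\<close>; if it saw
      only one, \<open>x, y, u\<close> would induce a P3 missing the edge \<open>e e'\<close>. Hence
      an edge between two such \<open>u\<close> would give a K4 with \<open>xy\<close>.\<close>
    have adj: "E x u \<and> E y u" if u: "u \<in> ?Na \<union> ?Nb \<union> ?Nc" for u
    proof -
      obtain d e e' where d: "d \<in> {a, b, c}" "e \<in> {a, b, c}" "e' \<in> {a, b, c}" "E d e" "E d e'" "E e e'"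
        "E d u" "\<not> E e u" "\<not> E e' u"
        using u T sym unfolding N_def by (elim UnE) blast+
      have xy: "\<not> E d x" "\<not> E e x" "\<not> E e' x" "\<not> E d y" "\<not> E e y" "\<not> E e' y"
        using edge d(1-3) unfolding N_def by blast+
      have "E x u \<or> E y u"
        using p3_p2[of u d e x y] d xy edge(3) irrefl sym by metis
      moreover have "x \<noteq> u" "y \<noteq> u"
        using d xy by blast+
      ultimately show ?thesis
        using p3_p2[of x y u e e'] p3_p2[of y x u e e'] d xy edge(3) sym by metis
    qed
    have "stable_set E (?Na \<union> ?Nb \<union> ?Nc)"
      unfolding stable_set_def using adj k4[of x y] edge(3) by blast
    then have s: "colourable E (?Na \<union> ?Nb \<union> ?Nc) 1"
      by (rule colourable_stable)
    have "colourable E ?N0 3"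
    proof (rule a0)
      show "card K \<le> 3" if "K \<subseteq> ?N0" "clique E K" for K
        using clique_card_le_3[OF subset_trans[OF that(1) NV] that(2)] .
    qed simp
    then have "colourable E (?N0 \<union> (?Na \<union> ?Nb \<union> ?Nc) \<union> ?Nab \<union> ?Nac \<union> ?Nbc) (3 + 1 + 1 + 1 + 1)"
      using s ab ac bc by (intro colourable_Un)
    then show ?thesis
      by (rule colourable_mono) (use V in auto)
  next
    case tri
    have pq: "E a p" "E a q" "\<not> E b p" "\<not> E b q" "\<not> E c p" "\<not> E c q"
      and x: "\<not> E a x" "\<not> E b x" "\<not> E c x"
      using tri unfolding N_def by auto
    \<comment> \<open>Suppose \<open>z\<close> sees exactly one of \<open>p, q\<close>. The path
      \<open>z, b, c\<close> and the edge \<open>q' x\<close> force \<open>E z x\<close>, and then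
      \<open>z, b, c, a, p', x\<close> is a co-A.\<close>
    have half: False
      if z: "z \<in> ?Nab" "E z p'" "\<not> E z q'" and pq': "p' = p \<and> q' = q \<or> p' = q \<and> q' = p" for z p' q'
    proof -
      have zs: "E a z" "E b z" "\<not> E c z"
        using z unfolding N_def by auto
      have "E z x"
        using p3_p2[of z b c q' x] zs z(2,3) pq' pq x tri(5-7) T irrefl sym by metis
      then show False
        using co_A[of z b c a p' x] zs z(2,3) pq' pq x tri(5-7) T sym by metis
    qed
    \<comment> \<open>Seeing both \<open>p\<close> and \<open>q\<close> gives a K4 with
      \<open>a\<close>; seeing neither leaves the path \<open>z, b, c\<close> apart from
      \<open>pq\<close>, unless \<open>z = c\<close>.\<close>
    have Nab: "z = c" if z: "z \<in> ?Nab" for z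
    proof (rule ccontr)
      assume "z \<noteq> c"
      have zs: "E a z" "E b z" "\<not> E c z"
        using z unfolding N_def by auto
      have "\<not> (E z p \<and> E z q)"
        using k4[of a p q z] pq zs tri(7) sym by metis
      moreover have "E z p \<or> E z q"
        using p3_p2[of z b c p q] \<open>z \<noteq> c\<close> zs pq T tri(7) sym by metis
      ultimately show False
        using half[OF z, of p q] half[OF z, of q p] by blast
    qed
    have "colourable E ?Na 2"
    proof (rule a0)
      have "False" if "x \<in> ?Na" "y \<in> ?Na" "z \<in> ?Na" "E x y" "E x z" "E y z" for x y z
        using that k4[of a x y z] unfolding N_def by blast
      then show "\<And>K. \<lbrakk>K \<subseteq> ?Na; clique E K\<rbrakk> \<Longrightarrow> card K \<le> 2"
        using clique_card_le_2[of ?Na] by blast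
    qed auto
    \<comment> \<open>What is left of \<open>?Nab\<close> can share the colour of
      \<open>?N0\<close>, which pays for the two colours on \<open>?Na\<close>.\<close>
    moreover have "stable_set E (insert c ?N0)"
      using tri(1) irrefl sym unfolding stable_set_def N_def by blast
    then have "colourable E (insert c ?N0) 1"
      by (rule colourable_stable)
    ultimately have "colourable E (insert c ?N0 \<union> ?Na \<union> ?Nb \<union> ?Nc \<union> ?Nac \<union> ?Nbc) (1 + 2 + 1 + 1 + 1 + 1)"
      using b1 c1 ac bc by (intro colourable_Un)
    then show ?thesis
      by (rule colourable_mono) (use V Nab in auto)
  next
    case none
    have "colourable E (?N0 \<union> ?Na) 2"
    proof (rule a0)
      show "card K \<le> 2" if "K \<subseteq> ?N0 \<union> ?Na" "clique E K" for K
        using none that by (rule clique_card_le_2)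
    qed simp
    then have "colourable E (?N0 \<union> ?Na \<union> ?Nb \<union> ?Nc \<union> ?Nab \<union> ?Nac \<union> ?Nbc) (2 + 1 + 1 + 1 + 1 + 1)"
      using b1 c1 ab ac bc by (intro colourable_Un)
    then show ?thesis
      by (rule colourable_mono) (use V in auto)
  qed
qed

theorem colourable_V: "colourable E V 7"
proof (cases "\<exists>a b c. E a b \<and> E a c \<and> E b c")
  case False
  then have "colourable E V 4"
    using colourable_triangle_free by blast
  then show ?thesis
    by (rule colourable_mono) auto
next
  case True
  then obtain a b c where T: "E a b" "E a c" "E b c"
    by blast
  \<comment> \<open>This holds if the private neighbourhood of \<open>d\<close> in the triangle
    \<open>d e e'\<close> contains an edge. At most one triangle vertex has this property, and it
    takes the role of \<open>a\<close> in \<open>colourable_around_triangle\<close>.\<close>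
  define edge where "edge d e e' \<longleftrightarrow> (\<exists>p q. E d p \<and> E d q \<and> E p q
      \<and> \<not> E e p \<and> \<not> E e q \<and> \<not> E e' p \<and> \<not> E e' q)" for d e e'
  have swap: "edge d e e' = edge d e' e" for d e e'
    unfolding edge_def by blast
  have one: "\<not> (edge d e e' \<and> edge e d e')" if "E d e" "E d e'" "E e e'" for d e e'
    using edge_in_one_part[OF that] unfolding edge_def by blast
  have around: "colourable E V 7"
    if "E d e" "E d e'" "E e e'" "\<not> edge e d e'" "\<not> edge e' d e" for d e e'
    using that(4,5) unfolding edge_def by (intro colourable_around_triangle[OF that(1-3)]) blast+
  have "\<not> (edge a b c \<and> edge b a c)" "\<not> (edge a b c \<and> edge c a b)" "\<not> (edge b a c \<and> edge c a b)"
    using one[of a b c] one[of a c b] one[of b c a] T sym swap by blast+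
  then show ?thesis
    using around[of a b c] around[of b a c] around[of c a b] T sym swap by blast
qed

end

section \<open>Excluding the cores one by one\<close>

lemma occurs_k4: "occurs k4 V E \<longleftrightarrow> induced_embeds (K_V 4) (K_E 4) V E"
proof -
  have "\<forall>i<4. \<forall>j<4. edges_of [(0,1),(0,2),(0,3),(1,2),(1,3),(2,3)] i j = K_E 4 i j"
    by (auto simp: edges_of_def K_E_def less_Suc_eq numeral_eq_Suc)
  then show ?thesis
    unfolding k4_def by (auto simp: induced_embeds_def K_V_def)
qed

lemma certificate_free:
  assumes "simple_graph V E" and "\<not> colourable E V 7" and "certificate F H cls ws"
    and "\<And>p. p \<in> set F \<Longrightarrow> \<not> occurs p V E" and "length cls = 7"
  shows "\<not> occurs H V E"
  using certificate_sound[OF assms(1,4,3)] assms(2,5) by auto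

text \<open>In a graph that is not 7-colourable no core can occur: each certificate relies on the
  absence of the earlier cores. Such a graph falls under \<open>triangles_sparse\<close>, where
  seven colours suffice.\<close>

theorem colourable_7:
  assumes simple: "simple_graph V E"
    and F: "\<not> occurs p3_p2 V E" "\<not> occurs k4 V E" "\<not> occurs codomino V E" "\<not> occurs co_A V E"
  shows "colourable E V 7"
proof (rule ccontr)
  assume no: "\<not> colourable E V 7"
  note free = certificate_free[OF simple no]
  have 1: "\<not> occurs wheel_0123_14 V E"
    by (rule free[OF wheel_0123_14_certificate]) (use F in auto)
  have 2: "\<not> occurs wheel_0123_0124 V E"
    by (rule free[OF wheel_0123_0124_certificate]) (use F 1 in auto)
  have 3: "\<not> occurs wheel_0123 V E"
    by (rule free[OF wheel_0123_certificate]) (use F 1 2 in auto)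
  have 4: "\<not> occurs wheel_013 V E"
    by (rule free[OF wheel_013_certificate]) (use F 1 2 3 in auto)
  have 5: "\<not> occurs wheel V E"
    by (rule free[OF wheel_certificate]) (use F 1 2 3 4 in auto)
  have 6: "\<not> occurs triangles_path V E"
    by (rule free[OF triangles_path_certificate]) (use F 1 2 3 4 5 in auto)
  have 7: "\<not> occurs triangles_matching V E"
    by (rule free[OF triangles_matching_certificate]) (use F 1 2 3 4 5 6 in auto)
  interpret triangles_sparse V E
    using simple F 6 7 by unfold_locales
  show False
    using no colourable_V by blast
qed

theorem theorem1p3:
  fixes V :: "'a set" and E :: "'a \<Rightarrow> 'a \<Rightarrow> bool"
  assumes "simple_graph V E"
    and "H_free P3_P2_V P3_P2_E V E"
    and "H_free (K_V 4) (K_E 4) V E"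
    and "H_free codomino_V codomino_E V E"
    and "H_free coA_V coA_E V E"
    and "D1 = {x \<in> V. clique_number (V - nbhd E x) E \<le> 2}"
    and "D2 = V - D1"
    and "\<not> induced_embeds D2 E (K_V 3) (K_E 3)"
  shows "chromatic_number V E \<le> 7"
proof (intro chromatic_number_le colourable_7)
  show "simple_graph V E"
    by (fact assms(1))
  show "\<not> occurs p3_p2 V E"
    using assms(2) by (simp add: H_free_def p3_p2_def P3_P2_V_def P3_P2_E_def)
  show "\<not> occurs k4 V E"
    using assms(3) by (simp add: H_free_def occurs_k4)
  show "\<not> occurs codomino V E"
    using assms(4) by (simp add: H_free_def codomino_def codomino_V_def codomino_E_def)
  show "\<not> occurs co_A V E"
    using assms(5) by (simp add: H_free_def co_A_def coA_V_def coA_E_def)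
qed

end
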